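(* Let $G$ be a finitely generated group, let $(M,d)$ be a compact metric space, and let $\alpha\colon G\to\operatorname{Homeo}(M)$ be an action (a group homomorphism into the group of homeomorphisms of $M$). Then $\alpha$ is cohomologically $C^0$-stable if and only if $\alpha$ is periodic, i.e. the image $\alpha(G)\le\operatorname{Homeo}(M)$ is a finite group.
   Context: $C^0(M)$ denotes the Banach space of real continuous functions on $M$ with the uniform norm $\|\phi\|_{C^0}=\sup_{x\in M}|\phi(x)|$. Write $g\cdot x$ for $\alpha(g)(x)$. Fix a finite symmetric generating set $S=S^{-1}$ of $G$ with $e\notin S$. A (real, continuous) cocycle over $\alpha$ is a map $c\colon G\times M\to\mathbb{R}$ such that $c(g,\cdot)\in C^0(M)$ for every $g\in G$ and $c(gh,x)=c(g,h\cdot x)+c(h,x)$ for all $g,h\in G$, $x\in M$. The linear space of cocycles is denoted $Z^1(\alpha)$ and is given the norm $\|c\|=\max_{s\in S}\|c(s,\cdot)\|_{C^0}$ (different finite generating sets give equivalent norms). Every $u\in C^0(M)$ determines the coboundary $\delta u\in Z^1(\alpha)$, $(\delta u)(g,x)=u(g\cdot x)-u(x)$, and $B(\alpha)=\delta(C^0(M))\subset Z^1(\alpha)$. The action $\alpha$ is called cohomologically $C^0$-stable when $B(\alpha)$ is closed in $Z^1(\alpha)$. *)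

theory Defs
  imports "HOL-Analysis.Analysis" "HOL-Algebra.Bij" "HOL-Algebra.Generated_Groups"
begin

text \<open>
  A compact metric space is rendered as a compact subset \<open>M\<close> of a type of class
  \<^class>\<open>metric_space\<close>. Maps on \<open>M\<close> and cocycles are extensional functions, so
  that equality of functions is equality on \<open>M\<close> (and on the carrier of the group).
\<close>

definition Homeo :: "'a::topological_space set \<Rightarrow> ('a \<Rightarrow> 'a) monoid" where
  "Homeo M = BijGroup M \<lparr>carrier := {f \<in> Bij M. \<exists>g. homeomorphism M M f g}\<rparr>"

definition C0 :: "'a::topological_space set \<Rightarrow> ('a \<Rightarrow> real) set" where
  "C0 M = {\<phi> \<in> extensional M. continuous_on M \<phi>}"

text \<open>The case distinction is needed since \<open>Sup {}\<close> is unspecified on the reals.\<close>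

definition C0_norm :: "'a set \<Rightarrow> ('a \<Rightarrow> real) \<Rightarrow> real" where
  "C0_norm M \<phi> = (if M = {} then 0 else (SUP x\<in>M. \<bar>\<phi> x\<bar>))"

definition cocycles ::
  "('g, 'b) monoid_scheme \<Rightarrow> 'a::topological_space set \<Rightarrow> ('g \<Rightarrow> 'a \<Rightarrow> 'a) \<Rightarrow> ('g \<Rightarrow> 'a \<Rightarrow> real) set"
  where
  "cocycles G M \<alpha> = {c \<in> carrier G \<rightarrow>\<^sub>E C0 M.
     \<forall>g\<in>carrier G. \<forall>h\<in>carrier G. \<forall>x\<in>M. c (g \<otimes>\<^bsub>G\<^esub> h) x = c g (\<alpha> h x) + c h x}"

text \<open>
  Inserting \<open>0\<close> only matters for \<open>S = {}\<close>, which is a generating set of the trivial group.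
\<close>

definition cocycle_norm :: "'a set \<Rightarrow> 'g set \<Rightarrow> ('g \<Rightarrow> 'a \<Rightarrow> real) \<Rightarrow> real" where
  "cocycle_norm M S c = Max (insert 0 ((\<lambda>s. C0_norm M (c s)) ` S))"

definition cocycle_dist ::
  "'a set \<Rightarrow> 'g set \<Rightarrow> ('g \<Rightarrow> 'a \<Rightarrow> real) \<Rightarrow> ('g \<Rightarrow> 'a \<Rightarrow> real) \<Rightarrow> real" where
  "cocycle_dist M S c c' = cocycle_norm M S (\<lambda>g x. c g x - c' g x)"

definition coboundary ::
  "('g, 'b) monoid_scheme \<Rightarrow> 'a set \<Rightarrow> ('g \<Rightarrow> 'a \<Rightarrow> 'a) \<Rightarrow> ('a \<Rightarrow> real) \<Rightarrow> ('g \<Rightarrow> 'a \<Rightarrow> real)" where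
  "coboundary G M \<alpha> u = (\<lambda>g\<in>carrier G. \<lambda>x\<in>M. u (\<alpha> g x) - u x)"

definition coboundaries ::
  "('g, 'b) monoid_scheme \<Rightarrow> 'a::topological_space set \<Rightarrow> ('g \<Rightarrow> 'a \<Rightarrow> 'a) \<Rightarrow> ('g \<Rightarrow> 'a \<Rightarrow> real) set"
  where
  "coboundaries G M \<alpha> = coboundary G M \<alpha> ` C0 M"

text \<open>
  The topology is that of the norm distance on the space of cocycles; it is a genuine metric
  by \<open>Metric_space_cocycles\<close> below.
\<close>

definition cohomologically_C0_stable ::
  "('g, 'b) monoid_scheme \<Rightarrow> 'g set \<Rightarrow> 'a::topological_space set \<Rightarrow> ('g \<Rightarrow> 'a \<Rightarrow> 'a) \<Rightarrow> bool"
  where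
  "cohomologically_C0_stable G S M \<alpha> \<longleftrightarrow>
     closedin (Metric_space.mtopology (cocycles G M \<alpha>) (cocycle_dist M S)) (coboundaries G M \<alpha>)"

definition periodic_action :: "('g, 'b) monoid_scheme \<Rightarrow> ('g \<Rightarrow> 'a \<Rightarrow> 'a) \<Rightarrow> bool" where
  "periodic_action G \<alpha> \<longleftrightarrow> finite (\<alpha> ` carrier G)"

lemma subgroup_Homeo: "subgroup (carrier (Homeo M)) (BijGroup M)"
proof -
  interpret group "BijGroup M" by (rule group_BijGroup)
  show ?thesis
  proof (rule subgroupI)
    show "carrier (Homeo M) \<subseteq> carrier (BijGroup M)"
      by (auto simp: Homeo_def BijGroup_def)
    have "homeomorphism M M (\<lambda>x\<in>M. x) (\<lambda>x. x)"
      by (auto simp: homeomorphism_def cong: continuous_on_cong)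
    then show "carrier (Homeo M) \<noteq> {}"
      using id_Bij[of M] by (auto simp: Homeo_def)
  next
    fix f assume "f \<in> carrier (Homeo M)"
    then obtain g where f: "f \<in> Bij M" and g: "homeomorphism M M f g"
      by (auto simp: Homeo_def)
    have inv: "inv\<^bsub>BijGroup M\<^esub> f = (\<lambda>x\<in>M. inv_into M f x)"
      using f by (rule inv_BijGroup)
    have eq: "inv_into M f x = g x" if "x \<in> M" for x
    proof -
      have "g x \<in> M" "f (g x) = x"
        using g that by (auto simp: homeomorphism_def)
      moreover have "inj_on f M"
        using f by (simp add: Bij_def bij_betw_def)
      ultimately show ?thesis
        by (metis inv_into_f_f)
    qed
    have "homeomorphism M M (\<lambda>x\<in>M. inv_into M f x) f"
      using homeomorphism_symD[OF g] by (rule homeomorphism_cong) (auto simp: eq)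
    then show "inv\<^bsub>BijGroup M\<^esub> f \<in> carrier (Homeo M)"
      unfolding inv using restrict_inv_into_Bij[OF f] by (auto simp: Homeo_def)
  next
    fix f f' assume "f \<in> carrier (Homeo M)" "f' \<in> carrier (Homeo M)"
    then obtain g g' where f: "f \<in> Bij M" "f' \<in> Bij M"
      and g: "homeomorphism M M f g" "homeomorphism M M f' g'"
      by (auto simp: Homeo_def)
    have "homeomorphism M M (compose M f f') (g' \<circ> g)"
      using homeomorphism_compose[OF g(2) g(1)]
      by (rule homeomorphism_cong) (auto simp: compose_def)
    then show "f \<otimes>\<^bsub>BijGroup M\<^esub> f' \<in> carrier (Homeo M)"
      using f by (auto simp: Homeo_def BijGroup_def compose_Bij)
  qed
qed

lemma group_Homeo: "group (Homeo M)"
proof -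
  have "Homeo M = BijGroup M \<lparr>carrier := carrier (Homeo M)\<rparr>"
    by (simp add: Homeo_def)
  then show ?thesis
    using group.subgroup_imp_group[OF group_BijGroup subgroup_Homeo[of M]] by simp
qed

lemma hom_Homeo_in:
  assumes "\<alpha> \<in> hom G (Homeo M)" "g \<in> carrier G" "x \<in> M"
  shows "\<alpha> g x \<in> M"
  using assms Bij_imp_funcset[of "\<alpha> g" M] by (auto simp: hom_def Homeo_def Pi_iff)

lemma hom_Homeo_mult:
  assumes "\<alpha> \<in> hom G (Homeo M)" "g \<in> carrier G" "h \<in> carrier G" "x \<in> M"
  shows "\<alpha> (g \<otimes>\<^bsub>G\<^esub> h) x = \<alpha> g (\<alpha> h x)"
proof -
  have "\<alpha> g \<in> Bij M" "\<alpha> h \<in> Bij M"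
    using assms by (auto simp: hom_def Homeo_def Pi_iff)
  then show ?thesis
    using assms by (auto simp: hom_def Homeo_def BijGroup_def compose_def)
qed

lemma coboundaries_subset_cocycles:
  assumes "group G" and \<alpha>: "\<alpha> \<in> hom G (Homeo M)"
  shows "coboundaries G M \<alpha> \<subseteq> cocycles G M \<alpha>"
proof
  interpret group G by fact
  fix c assume "c \<in> coboundaries G M \<alpha>"
  then obtain u where u: "u \<in> C0 M" and c: "c = coboundary G M \<alpha> u"
    by (auto simp: coboundaries_def)
  have "(\<lambda>x\<in>M. u (\<alpha> g x) - u x) \<in> C0 M" if g: "g \<in> carrier G" for g
  proof -
    have "continuous_on M (\<alpha> g)"
      using \<alpha> g by (auto simp: hom_def Homeo_def homeomorphism_def Pi_iff)
    moreover have "continuous_on M u" "\<alpha> g ` M \<subseteq> M"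
      using u hom_Homeo_in[OF \<alpha> g] by (auto simp: C0_def)
    ultimately have "continuous_on M (\<lambda>x. u (\<alpha> g x) - u x)"
      by (intro continuous_on_diff) (rule continuous_on_compose2)
    then show ?thesis by (simp add: C0_def cong: continuous_on_cong)
  qed
  then show "c \<in> cocycles G M \<alpha>"
    using \<alpha> by (auto simp: c cocycles_def coboundary_def hom_Homeo_in hom_Homeo_mult)
qed

lemma C0_bdd:
  assumes "compact M" "\<phi> \<in> C0 M" "\<psi> \<in> C0 M"
  shows "bdd_above ((\<lambda>x. \<bar>\<phi> x - \<psi> x\<bar>) ` M)"
proof -
  have "continuous_on M (\<lambda>x. \<bar>\<phi> x - \<psi> x\<bar>)"
    using assms by (auto simp: C0_def intro!: continuous_intros)
  from compact_continuous_image[OF this assms(1)] show ?thesis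
    by (simp add: bounded_imp_bdd_above compact_imp_bounded)
qed

lemma Metric_space_cocycles:
  assumes "group G" "finite S" "S \<subseteq> carrier G" "generate G S = carrier G"
    and M: "compact M" and \<alpha>: "\<alpha> \<in> hom G (Homeo M)"
  shows "Metric_space (cocycles G M \<alpha>) (cocycle_dist M S)"
proof
  interpret group G by fact
  fix c c' c''
  have fin: "finite (insert 0 ((\<lambda>s. C0_norm M (b s)) ` S))" for b :: "'a \<Rightarrow> 'c \<Rightarrow> real"
    using assms by simp
  show "0 \<le> cocycle_dist M S c c'"
    unfolding cocycle_dist_def cocycle_norm_def by (rule Max_ge[OF fin]) simp
  show "cocycle_dist M S c c' = cocycle_dist M S c' c"
    unfolding cocycle_dist_def cocycle_norm_def C0_norm_def by (simp add: abs_minus_commute)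
  have le: "\<bar>a s x - b s x\<bar> \<le> cocycle_dist M S a b"
    if "a \<in> cocycles G M \<alpha>" "b \<in> cocycles G M \<alpha>" "s \<in> S" "x \<in> M" for a b s x
  proof -
    have "a s \<in> C0 M" "b s \<in> C0 M" using that assms(3) by (auto simp: cocycles_def)
    then have "\<bar>a s x - b s x\<bar> \<le> C0_norm M (\<lambda>x. a s x - b s x)"
      using that(4) cSUP_upper[OF that(4) C0_bdd[OF M, of "a s" "b s"]]
      by (auto simp: C0_norm_def)
    also have "\<dots> \<le> cocycle_dist M S a b"
      unfolding cocycle_dist_def cocycle_norm_def
      using that by (intro Max_ge[OF fin]) auto
    finally show ?thesis .
  qed
  assume c: "c \<in> cocycles G M \<alpha>" and c': "c' \<in> cocycles G M \<alpha>"
  show "cocycle_dist M S c c' = 0 \<longleftrightarrow> c = c'"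
  proof
    assume "c = c'"
    then have "(\<lambda>s. C0_norm M (\<lambda>x. c s x - c' s x)) ` S \<subseteq> {0}"
      by (auto simp: C0_norm_def)
    then have "insert 0 ((\<lambda>s. C0_norm M (\<lambda>x. c s x - c' s x)) ` S) = {0}"
      by blast
    then show "cocycle_dist M S c c' = 0"
      unfolding cocycle_dist_def cocycle_norm_def by (simp only: Max_singleton)
  next
    assume 0: "cocycle_dist M S c c' = 0"
    have mult: "a (g \<otimes>\<^bsub>G\<^esub> h) x = a g (\<alpha> h x) + a h x"
      if "a \<in> cocycles G M \<alpha>" "g \<in> carrier G" "h \<in> carrier G" "x \<in> M" for a g h x
      using that by (auto simp: cocycles_def)
    have cocycle_one: "a \<one>\<^bsub>G\<^esub> x = 0" if "a \<in> cocycles G M \<alpha>" "x \<in> M" for a x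
    proof -
      have "\<alpha> \<one>\<^bsub>G\<^esub> x = x"
        using hom_one[OF \<alpha> \<open>group G\<close> group_Homeo] that by (simp add: Homeo_def BijGroup_def)
      then show ?thesis using mult[OF that(1) one_closed one_closed that(2)] by simp
    qed
    have gen: "c g x = c' g x" if "g \<in> generate G S" "x \<in> M" for g x
      using that
    proof (induction arbitrary: x rule: generate.induct)
      case one
      then show ?case by (simp only: cocycle_one[OF c] cocycle_one[OF c'])
    next
      case (incl h)
      then show ?case using le[OF c c' incl] 0 by simp
    next
      case (inv h)
      have h: "h \<in> carrier G" "inv\<^bsub>G\<^esub> h \<in> carrier G" using inv assms(3) by auto
      define y where "y = \<alpha> (inv\<^bsub>G\<^esub> h) x"
      have y: "y \<in> M" using hom_Homeo_in[OF \<alpha> h(2) inv.prems] by (simp add: y_def)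
      have "a (inv\<^bsub>G\<^esub> h) x = - a h y" if "a \<in> cocycles G M \<alpha>" for a
        using mult[OF that h inv.prems] cocycle_one[OF that inv.prems] h by (simp add: y_def)
      from this[OF c] this[OF c'] show ?case using le[OF c c' inv.hyps y] 0 by simp
    next
      case (eng h1 h2)
      have h: "h1 \<in> carrier G" "h2 \<in> carrier G" using eng assms(4) by auto
      show ?case
        using eng hom_Homeo_in[OF \<alpha> h(2) eng.prems]
        by (simp add: mult[OF c h eng.prems] mult[OF c' h eng.prems])
    qed
    have C: "c \<in> carrier G \<rightarrow>\<^sub>E C0 M" "c' \<in> carrier G \<rightarrow>\<^sub>E C0 M"
      using c c' by (auto simp: cocycles_def)
    show "c = c'"
    proof (rule PiE_ext[OF C])
      fix g assume g: "g \<in> carrier G"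
      then have "c g \<in> extensional M" "c' g \<in> extensional M"
        using C by (auto simp: C0_def)
      then show "c g = c' g" using gen g assms(4) by (auto intro: extensionalityI)
    qed
  qed
  assume c'': "c'' \<in> cocycles G M \<alpha>"
  have nonneg: "0 \<le> cocycle_dist M S a b" for a b
    unfolding cocycle_dist_def cocycle_norm_def by (rule Max_ge[OF fin]) simp
  have "C0_norm M (\<lambda>x. c s x - c'' s x) \<le> cocycle_dist M S c c' + cocycle_dist M S c' c''"
    if s: "s \<in> S" for s
  proof (cases "M = {}")
    case True
    then show ?thesis using nonneg by (simp add: C0_norm_def)
  next
    case False
    have "\<bar>c s x - c'' s x\<bar> \<le> cocycle_dist M S c c' + cocycle_dist M S c' c''" if "x \<in> M" for x
      using le[OF c c' s that] le[OF c' c'' s that] by linarith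
    then show ?thesis using False by (auto simp: C0_norm_def intro: cSUP_least)
  qed
  then show "cocycle_dist M S c c'' \<le> cocycle_dist M S c c' + cocycle_dist M S c' c''"
    using fin nonneg unfolding cocycle_dist_def[of M S c c''] cocycle_norm_def
    by (auto simp: Max_le_iff)
qed

end

theory Submission
  imports Defs
begin

text \<open>
  Let \<open>\<alpha>(G)\<close> be finite. If a cocycle \<open>c\<close> is a limit of coboundaries, then \<open>c(g, x) = 0\<close> whenever
  \<open>g\<close> fixes \<open>x\<close>, because coboundaries have this property and evaluation at \<open>(g, x)\<close> is continuous
  (\<open>limit_vanishes_on_kernel\<close>). So \<open>c(g, \<cdot>)\<close> depends on \<open>\<alpha>(g)\<close> only, and averaging the cocycle
  identity over the finite group \<open>\<alpha>(G)\<close> shows that minus the average of \<open>c\<close> is a function with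
  coboundary \<open>c\<close> (\<open>coboundary_if_vanishes_on_kernel\<close>).

  Let \<open>\<alpha>(G)\<close> be infinite. Then the orbits cannot all be exhausted by one word ball
  (\<open>periodic_if_orbits_bounded\<close>), so for every \<open>n\<close> some orbit contains two points that are at word
  distance \<open>n + 1\<close>. Spreading a bump at one of them along the action, with a height that decays
  linearly in the word distance, gives a continuous \<open>u\<close> with values in \<open>[0, 1]\<close> that takes the
  values \<open>0\<close> and \<open>1\<close> on this pair but changes by at most \<open>1/n\<close> under each generator
  (\<open>slowly_varying\<close>). Take such functions \<open>u\<^sub>j\<close> for rapidly growing \<open>n\<^sub>j\<close>. The series
  \<open>\<Sum>\<^sub>j 4\<^sup>j \<delta>u\<^sub>j\<close> converges to a cocycle in the closure of the coboundaries. On the \<open>k\<close>-th pair of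
  points the \<open>k\<close>-th term contributes \<open>4\<^sup>k\<close>, the earlier terms together at most about a third of
  this, and the later ones a bounded amount since their \<open>n\<^sub>j\<close> is huge compared with the word
  distance \<open>n\<^sub>k + 1\<close>. Hence the limit is unbounded over \<open>G \<times> M\<close>, whereas every coboundary is
  bounded by compactness of \<open>M\<close> (\<open>not_stable_if_not_periodic\<close>).
\<close>

section \<open>Finite maxima and lacunary rates\<close>

lemma continuous_on_Max_image:
  fixes f :: "'i \<Rightarrow> 'a::topological_space \<Rightarrow> 'b::linorder_topology"
  assumes "finite I" "I \<noteq> {}" "\<And>i. i \<in> I \<Longrightarrow> continuous_on A (f i)"
  shows "continuous_on A (\<lambda>y. Max ((\<lambda>i. f i y) ` I))"
  using assms by (induction rule: finite_ne_induct) (auto intro: continuous_on_max)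

text \<open>
  The numbers \<open>n\<^sub>j\<close> of the lacunary series. One factor \<open>4\<^sup>j\<close> of \<open>8\<^sup>j\<close> compensates the coefficient of
  the \<open>j\<close>-th term and the remaining \<open>2\<^sup>j\<close> makes the series converge; the factor \<open>n\<^sub>j + 1\<close> is the word
  distance over which the next term must stay small.
\<close>

primrec slowness :: "nat \<Rightarrow> nat" where
  "slowness 0 = 1"
| "slowness (Suc j) = 8 ^ Suc j * Suc (slowness j)"

lemma slowness_mono: "mono slowness"
proof (intro mono_iff_le_Suc[THEN iffD2] allI)
  fix j
  have "1 * slowness j \<le> 8 ^ Suc j * Suc (slowness j)" by (intro mult_le_mono) auto
  then show "slowness j \<le> slowness (Suc j)" by simp
qed

lemma slowness_pos: "0 < slowness j"
  by (induction j) auto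

lemma slowness_gap:
  assumes "k < j"
  shows "real (Suc (slowness k)) * (4 ^ j / real (slowness j)) \<le> (1/2) ^ j"
proof -
  obtain i where j: "j = Suc i" "k \<le> i" using assms by (cases j) auto
  then have "8 ^ j * Suc (slowness k) \<le> slowness j"
    using monoD[OF slowness_mono j(2)] by simp
  then have "real (8 ^ j * Suc (slowness k)) \<le> real (slowness j)" by (rule of_nat_mono)
  moreover have "(8::real) ^ j = 2 ^ j * 4 ^ j" by (simp flip: power_mult_distrib)
  ultimately show ?thesis
    using slowness_pos[of j] by (simp add: field_simps)
qed

lemma slowness_ge: "4 ^ j / real (slowness j) \<le> (1/2) ^ j"
proof (cases j)
  case (Suc i)
  have "1 * (4 ^ j / real (slowness j)) \<le> real (Suc (slowness 0)) * (4 ^ j / real (slowness j))"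
    by (intro mult_right_mono) auto
  then show ?thesis using slowness_gap[of 0 j] Suc by simp
qed simp

section \<open>Finitely generated groups acting on compact spaces\<close>

locale finitely_generated_action = group G
  for G :: "('g, 'b) monoid_scheme" (structure) +
  fixes S :: "'g set"
    and M :: "'a::metric_space set"
    and \<alpha> :: "'g \<Rightarrow> 'a \<Rightarrow> 'a"
  assumes finite_S: "finite S"
    and S_carrier: "S \<subseteq> carrier G"
    and generate_S: "generate G S = carrier G"
    and S_symmetric: "m_inv G ` S = S"
    and compact_M: "compact M"
    and hom_\<alpha>: "\<alpha> \<in> hom G (Homeo M)"
begin

lemma act_in: "g \<in> carrier G \<Longrightarrow> x \<in> M \<Longrightarrow> \<alpha> g x \<in> M"
  by (rule hom_Homeo_in[OF hom_\<alpha>])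

lemma act_mult: "g \<in> carrier G \<Longrightarrow> h \<in> carrier G \<Longrightarrow> x \<in> M \<Longrightarrow> \<alpha> (g \<otimes> h) x = \<alpha> g (\<alpha> h x)"
  by (rule hom_Homeo_mult[OF hom_\<alpha>])

lemma act_one: "x \<in> M \<Longrightarrow> \<alpha> \<one> x = x"
  using hom_one[OF hom_\<alpha> is_group group_Homeo] by (simp add: Homeo_def BijGroup_def)

lemma act_extensional: "g \<in> carrier G \<Longrightarrow> \<alpha> g \<in> extensional M"
  using hom_\<alpha> by (auto simp: hom_def Homeo_def Bij_def Pi_iff)

lemma continuous_act: "g \<in> carrier G \<Longrightarrow> continuous_on M (\<alpha> g)"
  using hom_\<alpha> by (auto simp: hom_def Homeo_def homeomorphism_def Pi_iff)

lemma continuous_compose_act: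
  assumes "continuous_on M f" "g \<in> carrier G"
  shows "continuous_on M (\<lambda>x. f (\<alpha> g x))"
  using act_in[OF assms(2)]
  by (intro continuous_on_compose2[OF assms(1) continuous_act[OF assms(2)]]) auto

lemma S_in: "s \<in> S \<Longrightarrow> s \<in> carrier G"
  using S_carrier by auto

lemma inv_S: "s \<in> S \<Longrightarrow> inv s \<in> S"
  using S_symmetric by blast

text \<open>
  Inverses of generators are generators, so left multiplication by generators alone reaches every
  element.
\<close>

lemma carrier_induct [consumes 1, case_names one mult]:
  assumes "g \<in> carrier G" "P \<one>"
    and step: "\<And>s g. s \<in> S \<Longrightarrow> g \<in> carrier G \<Longrightarrow> P g \<Longrightarrow> P (s \<otimes> g)"
  shows "P g"
proof -
  have "\<forall>h\<in>carrier G. P h \<longrightarrow> P (g \<otimes> h)" if "g \<in> generate G S" for g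
    using that
  proof (induction rule: generate.induct)
    case (eng h1 h2)
    then have "h1 \<in> carrier G" "h2 \<in> carrier G" by (auto simp: generate_S)
    then show ?case using eng by (simp add: m_assoc)
  qed (auto intro: step inv_S)
  then show ?thesis using assms(1,2) generate_S by force
qed

text \<open>
  Words are built from the left, since growth of an orbit is tested by applying one more generator
  to the points reached so far.
\<close>

primrec word_ball :: "nat \<Rightarrow> 'g set" where
  "word_ball 0 = {\<one>}"
| "word_ball (Suc n) = word_ball n \<union> (\<lambda>(s, g). s \<otimes> g) ` (S \<times> word_ball n)"

lemma finite_word_ball: "finite (word_ball n)"
  by (induction n) (auto simp: finite_S)

lemma word_ball_carrier: "word_ball n \<subseteq> carrier G"
  by (induction n) (auto dest: S_in)

lemma word_ball_in: "g \<in> word_ball n \<Longrightarrow> g \<in> carrier G"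
  using word_ball_carrier by auto

lemma one_in_word_ball: "\<one> \<in> word_ball n"
  by (induction n) auto

lemma word_ball_mono: "m \<le> n \<Longrightarrow> word_ball m \<subseteq> word_ball n"
  by (rule lift_Suc_mono_le[of word_ball]) auto

lemma word_ball_mult_left: "s \<in> S \<Longrightarrow> g \<in> word_ball n \<Longrightarrow> s \<otimes> g \<in> word_ball (Suc n)"
  by auto

text \<open>
  Needed because a function of the form \<open>y \<mapsto> \<phi>(g y)\<close> sees a move of \<open>y\<close> as right multiplication of
  \<open>g\<close>.
\<close>

lemma word_ball_mult_right: "g \<in> word_ball n \<Longrightarrow> s \<in> S \<Longrightarrow> g \<otimes> s \<in> word_ball (Suc n)"
proof (induction n arbitrary: g)
  case 0
  have "s \<otimes> \<one> \<in> word_ball (Suc 0)" using 0 by (intro word_ball_mult_left) auto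
  then show ?case using 0 S_in by auto
next
  case (Suc n)
  show ?case
  proof (cases "g \<in> word_ball n")
    case True
    then show ?thesis using Suc by auto
  next
    case False
    then obtain t h where g: "t \<in> S" "h \<in> word_ball n" "g = t \<otimes> h"
      using Suc by auto
    then have "g \<otimes> s = t \<otimes> (h \<otimes> s)"
      using Suc.prems(2) by (simp add: m_assoc S_in word_ball_in)
    then show ?thesis
      using word_ball_mult_left[OF g(1) Suc.IH[OF g(2) Suc.prems(2)]] by (simp only:)
  qed
qed

lemma word_ball_exhausts:
  assumes "g \<in> carrier G"
  obtains n where "g \<in> word_ball n"
proof -
  have "\<exists>n. g \<in> word_ball n"
    using assms
  proof (induction rule: carrier_induct)
    case one
    show ?case using one_in_word_ball by blast
  next
    case (mult s g)
    then show ?case using word_ball_mult_left by blast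
  qed
  then show ?thesis using that by blast
qed

text \<open>
  The cocycle identity is a triangle inequality along a word. It is stated for an arbitrary function
  satisfying the identity, so that it covers differences of cocycles and coboundaries alike.
\<close>

lemma cocycle_growth:
  fixes a :: "'g \<Rightarrow> 'a \<Rightarrow> real"
  assumes mult: "\<And>g h x. g \<in> carrier G \<Longrightarrow> h \<in> carrier G \<Longrightarrow> x \<in> M
      \<Longrightarrow> a (g \<otimes> h) x = a g (\<alpha> h x) + a h x"
    and bound: "\<And>s x. s \<in> S \<Longrightarrow> x \<in> M \<Longrightarrow> \<bar>a s x\<bar> \<le> e"
    and "0 \<le> e" "g \<in> word_ball n" "x \<in> M"
  shows "\<bar>a g x\<bar> \<le> real n * e"
  using assms(4)
proof (induction n arbitrary: g)
  case 0
  have "a \<one> x = 0" using mult[of \<one> \<one> x] assms(5) by (simp add: act_one)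
  then show ?case using 0 by simp
next
  case (Suc n)
  show ?case
  proof (cases "g \<in> word_ball n")
    case True
    then have "\<bar>a g x\<bar> \<le> real n * e" by (rule Suc.IH)
    then show ?thesis using assms(3) by (simp add: algebra_simps)
  next
    case False
    then obtain s h where g: "s \<in> S" "h \<in> word_ball n" "g = s \<otimes> h"
      using Suc by auto
    have "a g x = a s (\<alpha> h x) + a h x"
      using g mult assms(5) by (simp add: S_in word_ball_in)
    moreover have "\<bar>a s (\<alpha> h x)\<bar> \<le> e"
      using bound g act_in assms(5) word_ball_in by blast
    ultimately show ?thesis using Suc.IH[OF g(2)] by (simp add: algebra_simps)
  qed
qed

section \<open>Actions with uniformly bounded orbits\<close>

text \<open>
  Suppose that on every orbit the ball of radius \<open>n + 1\<close> reaches nothing beyond the ball of radius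
  \<open>n\<close>. Which pairs of elements of the larger ball agree at \<open>z\<close> is then a finite amount of data
  \<open>R z\<close>, and it determines for each \<open>g\<close> an element of the smaller ball that agrees with \<open>g\<close> at \<open>z\<close>:
  a word is reduced letter by letter, and each reduction is recorded in \<open>R z\<close>. So \<open>\<alpha> g\<close> is determined
  by a function from the finitely many values of \<open>R\<close> into a finite ball.
\<close>

lemma periodic_if_orbits_bounded:
  assumes stop: "\<And>z g. z \<in> M \<Longrightarrow> g \<in> word_ball (Suc n) \<Longrightarrow> \<exists>h\<in>word_ball n. \<alpha> g z = \<alpha> h z"
  shows "periodic_action G \<alpha>"
proof -
  let ?B = "word_ball (Suc n)"
  define R where "R z = {(g, h) \<in> ?B \<times> ?B. \<alpha> g z = \<alpha> h z}" for z
  have fin_R: "finite (R ` M)"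
    by (rule finite_subset[of _ "Pow (?B \<times> ?B)"])
      (auto simp: R_def finite_word_ball simp del: word_ball.simps)
  have normal_form: "\<exists>h\<in>word_ball n. \<forall>z\<in>M. R z = r \<longrightarrow> \<alpha> g z = \<alpha> h z"
    if "g \<in> carrier G" for g r
    using that
  proof (induction rule: carrier_induct)
    case one
    show ?case using one_in_word_ball by blast
  next
    case (mult s g)
    then obtain h where h: "h \<in> word_ball n" "\<And>z. z \<in> M \<Longrightarrow> R z = r \<Longrightarrow> \<alpha> g z = \<alpha> h z"
      by blast
    have sh: "s \<otimes> h \<in> ?B" using mult h by (intro word_ball_mult_left)
    have eq: "\<alpha> (s \<otimes> g) z = \<alpha> (s \<otimes> h) z" if "z \<in> M" "R z = r" for z
      using that mult h by (simp add: act_mult S_in word_ball_in)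
    \<comment> \<open>A reduction valid at one point with data \<open>r\<close> is valid at all of them.\<close>
    show ?case
    proof (cases "\<exists>z\<in>M. R z = r")
      case True
      then obtain z0 where z0: "z0 \<in> M" "R z0 = r" by blast
      obtain k where k: "k \<in> word_ball n" "\<alpha> (s \<otimes> h) z0 = \<alpha> k z0"
        using stop[OF z0(1) sh] by blast
      then have "(s \<otimes> h, k) \<in> r"
        using sh z0 by (auto simp: R_def)
      then have "\<alpha> (s \<otimes> h) z = \<alpha> k z" if "R z = r" for z
        using that by (auto simp: R_def)
      then show ?thesis using k(1) eq by metis
    next
      case False
      then show ?thesis using one_in_word_ball by blast
    qed
  qed
  have "\<alpha> ` carrier G \<subseteq> (\<lambda>k. \<lambda>z\<in>M. \<alpha> (k (R z)) z) ` (R ` M \<rightarrow>\<^sub>E word_ball n)"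
  proof
    fix f assume "f \<in> \<alpha> ` carrier G"
    then obtain g where g: "g \<in> carrier G" "f = \<alpha> g" by blast
    obtain k where k: "\<And>r. k r \<in> word_ball n"
        "\<And>r z. z \<in> M \<Longrightarrow> R z = r \<Longrightarrow> \<alpha> g z = \<alpha> (k r) z"
      using normal_form[OF g(1)] by metis
    have "f = (\<lambda>z\<in>M. \<alpha> (restrict k (R ` M) (R z)) z)"
      using act_extensional[OF g(1)] k(2)
      by (intro extensionalityI[of _ M]) (auto simp: g(2))
    moreover have "restrict k (R ` M) \<in> R ` M \<rightarrow>\<^sub>E word_ball n"
      using k(1) by auto
    ultimately show "f \<in> (\<lambda>k. \<lambda>z\<in>M. \<alpha> (k (R z)) z) ` (R ` M \<rightarrow>\<^sub>E word_ball n)"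
      by blast
  qed
  then show ?thesis
    unfolding periodic_action_def
    by (rule finite_subset) (intro finite_imageI finite_PiE fin_R finite_word_ball)
qed

section \<open>Slowly varying functions\<close>

definition spread :: "('a \<Rightarrow> real) \<Rightarrow> nat \<Rightarrow> 'a \<Rightarrow> real" where
  "spread \<phi> k y = Max ((\<lambda>g. \<phi> (\<alpha> g y)) ` word_ball k)"

lemma spread_ge: "g \<in> word_ball k \<Longrightarrow> \<phi> (\<alpha> g y) \<le> spread \<phi> k y"
  unfolding spread_def by (intro Max_ge) (auto simp: finite_word_ball)

lemma spread_obtains:
  obtains g where "g \<in> word_ball k" "spread \<phi> k y = \<phi> (\<alpha> g y)"
proof -
  have "spread \<phi> k y \<in> (\<lambda>g. \<phi> (\<alpha> g y)) ` word_ball k"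
    unfolding spread_def using one_in_word_ball by (intro Max_in) (auto simp: finite_word_ball)
  then show ?thesis using that by auto
qed

lemma spread_act_le:
  assumes "s \<in> S" "y \<in> M"
  shows "spread \<phi> k (\<alpha> s y) \<le> spread \<phi> (Suc k) y"
proof -
  obtain g where g: "g \<in> word_ball k" "spread \<phi> k (\<alpha> s y) = \<phi> (\<alpha> g (\<alpha> s y))"
    by (rule spread_obtains)
  then have "spread \<phi> k (\<alpha> s y) = \<phi> (\<alpha> (g \<otimes> s) y)"
    using assms by (simp add: act_mult S_in word_ball_in)
  also have "\<dots> \<le> spread \<phi> (Suc k) y"
    using g assms by (intro spread_ge word_ball_mult_right)
  finally show ?thesis .
qed

lemma continuous_spread: "continuous_on M \<phi> \<Longrightarrow> continuous_on M (spread \<phi> k)"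
  unfolding spread_def using one_in_word_ball
  by (intro continuous_on_Max_image) (auto simp: finite_word_ball word_ball_in intro: continuous_compose_act)

text \<open>
  Let \<open>\<phi>\<close> be a bump at \<open>x = g z\<close> that vanishes on the part of the orbit reached from \<open>z\<close> by the ball
  of radius \<open>n\<close>. The functions \<open>spread \<phi> k\<close> increase with \<open>k\<close>, and a generator shifts \<open>k\<close> by at most
  one. Averaging over \<open>k < n\<close> turns this shift into a telescoping sum, which is at most \<open>1\<close> before
  division by \<open>n\<close>.
\<close>

lemma slowly_varying:
  assumes "\<not> periodic_action G \<alpha>" "0 < n"
  obtains u z g where "continuous_on M u"
    and "\<And>y. y \<in> M \<Longrightarrow> 0 \<le> u y \<and> u y \<le> 1"
    and "\<And>s y. s \<in> S \<Longrightarrow> y \<in> M \<Longrightarrow> \<bar>u (\<alpha> s y) - u y\<bar> \<le> 1 / real n"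
    and "z \<in> M" "g \<in> word_ball (Suc n)" "u (\<alpha> g z) - u z = 1"
proof -
  obtain z g where z: "z \<in> M" and g: "g \<in> word_ball (Suc n)"
    and far: "\<And>h. h \<in> word_ball n \<Longrightarrow> \<alpha> h z \<noteq> \<alpha> g z"
    using periodic_if_orbits_bounded[of n] assms(1) by metis
  define x where "x = \<alpha> g z"
  define A where "A = (\<lambda>h. \<alpha> h z) ` word_ball n"
  have "A \<noteq> {}" "closed A"
    using one_in_word_ball by (auto simp: A_def finite_word_ball finite_imp_closed)
  moreover have "x \<notin> A"
    using far unfolding A_def x_def by (metis imageE)
  ultimately have A: "A \<noteq> {}" "closed A" "x \<notin> A" .
  define r where "r = infdist x A"
  have r: "0 < r" "\<And>h. h \<in> word_ball n \<Longrightarrow> r \<le> dist x (\<alpha> h z)"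
    using A infdist_pos_not_in_closed[of A x] by (auto simp: r_def A_def intro: infdist_le)
  define \<phi> where "\<phi> y = max 0 (1 - dist x y / r)" for y
  have \<phi>: "continuous_on M \<phi>" "0 \<le> \<phi> y" "\<phi> y \<le> 1" "\<phi> x = 1" for y
    using r(1) by (auto simp: \<phi>_def intro!: continuous_intros)
  define u where "u y = (\<Sum>k<n. spread \<phi> k y) / real n" for y
  have spread_bounds: "0 \<le> spread \<phi> k y" "spread \<phi> k y \<le> 1" for k y
    by (rule spread_obtains[where k = k and \<phi> = \<phi> and y = y]; simp add: \<phi>)+
  have le: "u (\<alpha> s y) \<le> u y + 1 / real n" if "s \<in> S" "y \<in> M" for s y
  proof -
    have "(\<Sum>k<n. spread \<phi> k (\<alpha> s y)) \<le> (\<Sum>k<n. spread \<phi> (Suc k) y)"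
      using spread_act_le that by (intro sum_mono) auto
    also have "\<dots> = (\<Sum>k<n. spread \<phi> k y) + (spread \<phi> n y - spread \<phi> 0 y)"
      using sum_lessThan_telescope[of "\<lambda>k. spread \<phi> k y" n] by (simp add: sum_subtractf)
    also have "\<dots> \<le> (\<Sum>k<n. spread \<phi> k y) + 1"
      using spread_bounds(2)[of n y] spread_bounds(1)[of 0 y] by simp
    finally have "u (\<alpha> s y) \<le> ((\<Sum>k<n. spread \<phi> k y) + 1) / real n"
      unfolding u_def by (rule divide_right_mono) simp
    then show ?thesis by (simp add: u_def add_divide_distrib)
  qed
  show ?thesis
  proof
    show "continuous_on M u"
      unfolding u_def using assms(2) by (intro continuous_intros continuous_spread \<phi>) auto
    fix y
    show "0 \<le> u y \<and> u y \<le> 1"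
      using sum_bounded_above[of "{..<n}" "\<lambda>k. spread \<phi> k y" 1] assms(2) spread_bounds
      by (auto simp: u_def sum_nonneg)
    fix s assume s: "s \<in> S" and y: "y \<in> M"
    \<comment> \<open>The opposite inequality is the one for the generator \<open>inv s\<close> at the point \<open>\<alpha> s y\<close>.\<close>
    have "\<alpha> (inv s) (\<alpha> s y) = y"
      using s y by (simp add: act_one S_in flip: act_mult)
    then have "u y \<le> u (\<alpha> s y) + 1 / real n"
      using le[OF inv_S[OF s] act_in[OF S_in[OF s] y]] by simp
    then show "\<bar>u (\<alpha> s y) - u y\<bar> \<le> 1 / real n"
      using le[OF s y] by linarith
  next
    show "z \<in> M" "g \<in> word_ball (Suc n)" by fact+
    have "spread \<phi> k x = 1" for k
      using spread_ge[OF one_in_word_ball, where \<phi> = \<phi> and k = k and y = x] spread_bounds(2)[of k x] z g \<phi>(4)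
      by (simp add: act_one act_in word_ball_in x_def del: word_ball.simps)
    then have "u x = 1" using assms(2) by (simp add: u_def)
    have "spread \<phi> k z = 0" if "k < n" for k
    proof -
      obtain h where h: "h \<in> word_ball k" "spread \<phi> k z = \<phi> (\<alpha> h z)"
        by (rule spread_obtains)
      then have "r \<le> dist x (\<alpha> h z)" using r(2) word_ball_mono[of k n] that by auto
      then show ?thesis using r(1) h(2) by (simp add: \<phi>_def)
    qed
    then have "u z = 0" by (simp add: u_def)
    then show "u (\<alpha> g z) - u z = 1" using \<open>u x = 1\<close> by (simp add: x_def)
  qed
qed

section \<open>The topology on cocycles\<close>

lemma cocycle_mult:
  assumes "c \<in> cocycles G M \<alpha>" "g \<in> carrier G" "h \<in> carrier G" "x \<in> M"
  shows "c (g \<otimes> h) x = c g (\<alpha> h x) + c h x"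
  using assms by (auto simp: cocycles_def)

lemma cocycle_dist_le:
  assumes "0 \<le> e" "\<And>s x. s \<in> S \<Longrightarrow> x \<in> M \<Longrightarrow> \<bar>a s x - b s x\<bar> \<le> e"
  shows "cocycle_dist M S a b \<le> e"
  unfolding cocycle_dist_def cocycle_norm_def using assms finite_S
  by (auto simp: C0_norm_def intro: cSUP_least)

lemma cocycle_dist_ge:
  assumes "a \<in> cocycles G M \<alpha>" "b \<in> cocycles G M \<alpha>" "s \<in> S" "x \<in> M"
  shows "\<bar>a s x - b s x\<bar> \<le> cocycle_dist M S a b"
proof -
  have "a s \<in> C0 M" "b s \<in> C0 M" using assms S_in by (auto simp: cocycles_def)
  then have "\<bar>a s x - b s x\<bar> \<le> C0_norm M (\<lambda>x. a s x - b s x)"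
    using assms(4) cSUP_upper[OF assms(4) C0_bdd[OF compact_M, of "a s" "b s"]]
    by (auto simp: C0_norm_def)
  also have "\<dots> \<le> cocycle_dist M S a b"
    unfolding cocycle_dist_def cocycle_norm_def
    using assms(3) finite_S by (intro Max_ge) auto
  finally show ?thesis .
qed

lemma stable_iff:
  "cohomologically_C0_stable G S M \<alpha> \<longleftrightarrow>
    (\<forall>c\<in>cocycles G M \<alpha>. (\<forall>e>0. \<exists>b\<in>coboundaries G M \<alpha>. cocycle_dist M S c b < e)
      \<longrightarrow> c \<in> coboundaries G M \<alpha>)"
proof -
  interpret Z: Metric_space "cocycles G M \<alpha>" "cocycle_dist M S"
    by (rule Metric_space_cocycles[OF is_group finite_S S_carrier generate_S compact_M hom_\<alpha>])
  have sub: "coboundaries G M \<alpha> \<subseteq> cocycles G M \<alpha>"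
    by (rule coboundaries_subset_cocycles[OF is_group hom_\<alpha>])
  show ?thesis
    unfolding cohomologically_C0_stable_def Z.closedin_metric
    using sub by (auto simp: disjnt_iff) (meson not_le subsetD)+
qed

section \<open>Periodic actions are stable\<close>

text \<open>
  A coboundary vanishes at \<open>(g, x)\<close> if \<open>g\<close> fixes \<open>x\<close>, and \<open>cocycle_growth\<close> bounds the error made at
  \<open>(g, x)\<close> by the distance of the cocycles times the word length of \<open>g\<close>.
\<close>

lemma limit_vanishes_on_kernel:
  assumes c: "c \<in> cocycles G M \<alpha>"
    and lim: "\<And>e. 0 < e \<Longrightarrow> \<exists>b\<in>coboundaries G M \<alpha>. cocycle_dist M S c b < e"
    and g: "g \<in> carrier G" and x: "x \<in> M" "\<alpha> g x = x"
  shows "c g x = 0"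
proof -
  obtain n where n: "g \<in> word_ball n" using word_ball_exhausts[OF g] .
  have "\<bar>c g x\<bar> \<le> 0 + e" if e: "0 < e" for e
  proof -
    obtain b where b: "b \<in> coboundaries G M \<alpha>" "cocycle_dist M S c b < e / (real n + 1)"
      using lim[of "e / (real n + 1)"] e by auto
    then have b': "b \<in> cocycles G M \<alpha>"
      using coboundaries_subset_cocycles[OF is_group hom_\<alpha>] by blast
    have "b g x = 0" using b(1) g x by (auto simp: coboundaries_def coboundary_def)
    then have "\<bar>c g x\<bar> = \<bar>c g x - b g x\<bar>" by simp
    also have "\<dots> \<le> real n * (e / (real n + 1))"
    proof (rule cocycle_growth[where a = "\<lambda>g x. c g x - b g x"])
      fix s y assume "s \<in> S" "y \<in> M"
      then show "\<bar>c s y - b s y\<bar> \<le> e / (real n + 1)"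
        using cocycle_dist_ge[OF c b'] b(2) by fastforce
    qed (use e n x c b' in \<open>auto simp: cocycle_mult\<close>)
    also have "\<dots> \<le> e" using e by (simp add: field_simps)
    finally show ?thesis by simp
  qed
  then have "\<bar>c g x\<bar> \<le> 0" by (rule field_le_epsilon)
  then show ?thesis by simp
qed

text \<open>
  Summing \<open>c(f, g x) = c(f g, x) - c(g, x)\<close> over \<open>f\<close> in the finite group \<open>\<alpha>(G)\<close>, where right
  translation by \<open>g\<close> permutes the summands, solves the cocycle equation by an average.
\<close>

lemma coboundary_if_vanishes_on_kernel:
  assumes per: "periodic_action G \<alpha>" and c: "c \<in> cocycles G M \<alpha>"
    and ker: "\<And>g x. g \<in> carrier G \<Longrightarrow> x \<in> M \<Longrightarrow> \<alpha> g x = x \<Longrightarrow> c g x = 0"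
  shows "c \<in> coboundaries G M \<alpha>"
proof -
  define F where "F = \<alpha> ` carrier G"
  have F: "finite F" "F \<noteq> {}" using per by (auto simp: F_def periodic_action_def)
  \<comment> \<open>The sum over \<open>\<alpha>(G)\<close> is taken with chosen preimages; \<open>descends\<close> shows that \<open>c\<close> does not see the choice.\<close>
  define rep where "rep f = inv_into (carrier G) \<alpha> f" for f
  have rep: "rep f \<in> carrier G" "\<alpha> (rep f) = f" if "f \<in> F" for f
    using that by (auto simp: rep_def F_def inv_into_into f_inv_into_f)
  have descends: "c g x = c h x"
    if gh: "g \<in> carrier G" "h \<in> carrier G" "\<alpha> g = \<alpha> h" and x: "x \<in> M" for g h x
  proof -
    define k where "k = inv g \<otimes> h"
    have k: "k \<in> carrier G" "g \<otimes> k = h" using gh by (simp_all add: k_def flip: m_assoc)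
    have "\<alpha> k x = \<alpha> (inv g) (\<alpha> g x)" using gh x by (simp add: k_def act_mult)
    also have "\<dots> = x" using act_mult[of "inv g" g x] gh(1) x by (simp add: act_one)
    finally have kx: "\<alpha> k x = x" .
    have "c h x = c g (\<alpha> k x) + c k x" using cocycle_mult[OF c gh(1) k(1) x] k by simp
    then show ?thesis using kx ker[OF k(1) x kx] by simp
  qed
  define u where "u = (\<lambda>x\<in>M. - (\<Sum>f\<in>F. c (rep f) x) / real (card F))"
  have cont: "continuous_on M (c g)" if "g \<in> carrier G" for g
    using c that by (auto simp: cocycles_def C0_def)
  have "continuous_on M (\<lambda>x. - (\<Sum>f\<in>F. c (rep f) x) / real (card F))"
    using F by (intro continuous_intros cont rep) auto
  then have u: "u \<in> C0 M"
    by (simp add: u_def C0_def cong: continuous_on_cong)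
  have key: "c g x = u (\<alpha> g x) - u x" if g: "g \<in> carrier G" and x: "x \<in> M" for g x
  proof -
    interpret H: group "Homeo M" by (rule group_Homeo)
    define \<tau> where "\<tau> f = \<alpha> (rep f \<otimes> g)" for f
    have "inj_on \<tau> F"
    proof (rule inj_onI)
      fix f f' assume ff: "f \<in> F" "f' \<in> F" "\<tau> f = \<tau> f'"
      have hom: "\<alpha> h \<in> carrier (Homeo M)" if "h \<in> carrier G" for h
        using hom_\<alpha> that by (auto simp: hom_def)
      have "f \<otimes>\<^bsub>Homeo M\<^esub> \<alpha> g = f' \<otimes>\<^bsub>Homeo M\<^esub> \<alpha> g"
        using ff rep g hom_mult[OF hom_\<alpha>] by (simp add: \<tau>_def)
      then show "f = f'"
        using H.right_cancel[OF hom[OF g]] hom rep ff by metis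
    qed
    moreover have "\<tau> ` F \<subseteq> F" using rep g by (auto simp: \<tau>_def F_def)
    ultimately have \<tau>: "bij_betw \<tau> F F"
      using endo_inj_surj[OF F(1)] by (auto simp: bij_betw_def)
    have "(\<Sum>f\<in>F. c (rep f) (\<alpha> g x)) = (\<Sum>f\<in>F. c (rep (\<tau> f)) x - c g x)"
    proof (rule sum.cong)
      fix f assume f: "f \<in> F"
      then have "\<tau> f \<in> F" using \<open>\<tau> ` F \<subseteq> F\<close> by auto
      then have "c (rep (\<tau> f)) x = c (rep f \<otimes> g) x"
        using rep f g x by (intro descends) (auto simp: \<tau>_def)
      then show "c (rep f) (\<alpha> g x) = c (rep (\<tau> f)) x - c g x"
        using cocycle_mult[OF c rep(1)[OF f] g x] by simp
    qed simp
    also have "\<dots> = (\<Sum>f\<in>F. c (rep f) x) - real (card F) * c g x"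
      using sum.reindex_bij_betw[OF \<tau>, of "\<lambda>f. c (rep f) x"] by (simp add: sum_subtractf)
    finally show ?thesis
      using F x act_in[OF g x] by (simp add: u_def field_simps)
  qed
  have "c = coboundary G M \<alpha> u"
  proof (rule PiE_ext[of _ "carrier G" "\<lambda>_. C0 M"])
    show "c \<in> carrier G \<rightarrow>\<^sub>E C0 M" using c by (simp add: cocycles_def)
    show "coboundary G M \<alpha> u \<in> carrier G \<rightarrow>\<^sub>E C0 M"
      using coboundaries_subset_cocycles[OF is_group hom_\<alpha>] u
      by (auto simp: coboundaries_def cocycles_def)
    fix g assume g: "g \<in> carrier G"
    show "c g = coboundary G M \<alpha> u g"
      using c g key[OF g]
      by (intro extensionalityI[of _ M]) (auto simp: coboundary_def cocycles_def C0_def)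
  qed
  then show ?thesis using u by (auto simp: coboundaries_def)
qed

lemma stable_if_periodic:
  assumes "periodic_action G \<alpha>"
  shows "cohomologically_C0_stable G S M \<alpha>"
  unfolding stable_iff
  using coboundary_if_vanishes_on_kernel[OF assms] limit_vanishes_on_kernel by metis

section \<open>Actions that are not periodic are not stable\<close>

text \<open>
  A gliding hump: the partial sums of a lacunary series of slowly varying functions have
  coboundaries that converge, but the \<open>k\<close>-th term forces every primitive of the limit to jump by
  about \<open>4\<^sup>k\<close> along one orbit.
\<close>

lemma not_stable_if_not_periodic:
  assumes np: "\<not> periodic_action G \<alpha>"
  shows "\<not> cohomologically_C0_stable G S M \<alpha>"
proof
  assume stable: "cohomologically_C0_stable G S M \<alpha>"
  have "\<exists>u z g. continuous_on M u \<and> (\<forall>y\<in>M. 0 \<le> u y \<and> u y \<le> 1) \<and>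
      (\<forall>s\<in>S. \<forall>y\<in>M. \<bar>u (\<alpha> s y) - u y\<bar> \<le> 1 / real (slowness j)) \<and>
      z \<in> M \<and> g \<in> word_ball (Suc (slowness j)) \<and> u (\<alpha> g z) - u z = 1" for j
    by (rule slowly_varying[OF np slowness_pos[of j]]) blast
  then obtain u z g where u_cont: "\<And>j. continuous_on M (u j)"
    and u_bounds: "\<And>j y. y \<in> M \<Longrightarrow> 0 \<le> u j y \<and> u j y \<le> 1"
    and u_slow: "\<And>j s y. s \<in> S \<Longrightarrow> y \<in> M \<Longrightarrow> \<bar>u j (\<alpha> s y) - u j y\<bar> \<le> 1 / real (slowness j)"
    and z: "\<And>j. z j \<in> M" and g: "\<And>j. g j \<in> word_ball (Suc (slowness j))"
    and u_jump: "\<And>j. u j (\<alpha> (g j) (z j)) - u j (z j) = 1"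
    by metis
  define a where "a j h x = 4 ^ j * (u j (\<alpha> h x) - u j x)" for j h x
  have a_mult: "a j (h \<otimes> h') x = a j h (\<alpha> h' x) + a j h' x"
    if "h \<in> carrier G" "h' \<in> carrier G" "x \<in> M" for j h h' x
    using that by (simp add: a_def act_mult algebra_simps)
  have a_slow: "\<bar>a j h x\<bar> \<le> real n * (4 ^ j / real (slowness j))"
    if "h \<in> word_ball n" "x \<in> M" for j n h x
  proof (rule cocycle_growth[where a = "a j"])
    fix s y assume "s \<in> S" "y \<in> M"
    then have "4 ^ j * \<bar>u j (\<alpha> s y) - u j y\<bar> \<le> 4 ^ j * (1 / real (slowness j))"
      using u_slow by (intro mult_left_mono) auto
    then show "\<bar>a j s y\<bar> \<le> 4 ^ j / real (slowness j)" by (simp add: a_def abs_mult)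
  qed (use that a_mult in auto)
  have a_geometric: "\<bar>a j h x\<bar> \<le> real n * (1/2) ^ j" if "h \<in> word_ball n" "x \<in> M" for j n h x
    using a_slow[OF that, of j] mult_left_mono[OF slowness_ge[of j], of "real n"] by simp
  have sum_a: "summable (\<lambda>j. a j h x)" if h: "h \<in> carrier G" and x: "x \<in> M" for h x
  proof -
    obtain n where "h \<in> word_ball n" using word_ball_exhausts[OF h] .
    then have "norm (a j h x) \<le> real n * (1/2) ^ j" for j using a_geometric x by simp
    then show ?thesis
      by (rule summable_comparison_test'[rotated]) (auto intro: summable_mult)
  qed
  have unif: "uniform_limit M (\<lambda>N x. \<Sum>j<N. a j h x) (\<lambda>x. \<Sum>j. a j h x) sequentially"
    if h: "h \<in> carrier G" for h
  proof -
    obtain n where "h \<in> word_ball n" using word_ball_exhausts[OF h] .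
    then show ?thesis using a_geometric
      by (intro Weierstrass_m_test[where M = "\<lambda>j. real n * (1/2) ^ j"]) (auto intro: summable_mult)
  qed
  define c where "c = (\<lambda>h\<in>carrier G. \<lambda>x\<in>M. \<Sum>j. a j h x)"
  have "continuous_on M (\<lambda>x. \<Sum>j. a j h x)" if h: "h \<in> carrier G" for h
  proof (rule uniform_limit_theorem[OF _ unif[OF h]])
    show "\<forall>\<^sub>F N in sequentially. continuous_on M (\<lambda>x. \<Sum>j<N. a j h x)"
      unfolding a_def using u_cont h
      by (intro always_eventually allI continuous_intros continuous_compose_act) auto
  qed simp
  then have "c h \<in> C0 M" if "h \<in> carrier G" for h
    using that by (simp add: c_def C0_def cong: continuous_on_cong)
  moreover have "c (h \<otimes> h') x = c h (\<alpha> h' x) + c h' x"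
    if "h \<in> carrier G" "h' \<in> carrier G" "x \<in> M" for h h' x
    using that by (simp add: c_def a_mult act_in suminf_add sum_a)
  ultimately have c: "c \<in> cocycles G M \<alpha>"
    by (auto simp: cocycles_def c_def)
  have "\<exists>b\<in>coboundaries G M \<alpha>. cocycle_dist M S c b < e" if e: "0 < e" for e
  proof -
    have "\<forall>\<^sub>F N in sequentially. \<forall>s\<in>S. \<forall>x\<in>M. dist (\<Sum>j<N. a j s x) (\<Sum>j. a j s x) < e / 2"
      using uniform_limitD[OF unif, of _ "e / 2"] e S_in
      by (intro eventually_ball_finite finite_S) auto
    then obtain N where N: "\<And>s x. s \<in> S \<Longrightarrow> x \<in> M \<Longrightarrow> dist (\<Sum>j<N. a j s x) (\<Sum>j. a j s x) < e / 2"
      using eventually_happens'[OF sequentially_bot] by blast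
    define v where "v = (\<lambda>x\<in>M. \<Sum>j<N. 4 ^ j * u j x)"
    have "continuous_on M (\<lambda>x. \<Sum>j<N. 4 ^ j * u j x)" by (intro continuous_intros u_cont)
    then have "v \<in> C0 M" by (simp add: v_def C0_def cong: continuous_on_cong)
    moreover have "cocycle_dist M S c (coboundary G M \<alpha> v) \<le> e / 2"
    proof (rule cocycle_dist_le)
      fix s x assume s: "s \<in> S" and x: "x \<in> M"
      have "coboundary G M \<alpha> v s x = (\<Sum>j<N. a j s x)"
        using s x act_in[OF S_in[OF s] x]
        by (simp add: coboundary_def v_def a_def S_in right_diff_distrib sum_subtractf)
      then show "\<bar>c s x - coboundary G M \<alpha> v s x\<bar> \<le> e / 2"
        using N[OF s x] s x S_in by (simp add: c_def dist_real_def abs_minus_commute)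
    qed (use e in simp)
    ultimately show ?thesis
      using e by (intro bexI[of _ "coboundary G M \<alpha> v"]) (auto simp: coboundaries_def)
  qed
  then have "c \<in> coboundaries G M \<alpha>"
    using stable c by (auto simp: stable_iff)
  then obtain v where v: "v \<in> C0 M" "c = coboundary G M \<alpha> v" by (auto simp: coboundaries_def)
  have "bounded (v ` M)"
    using v(1) compact_M by (auto simp: C0_def intro: compact_imp_bounded compact_continuous_image)
  then obtain B where B: "\<And>x. x \<in> M \<Longrightarrow> \<bar>v x\<bar> \<le> B"
    by (auto simp: bounded_iff)
  have "2 ^ k \<le> 2 * (2 * B + 2)" for k
  proof -
    have gk: "g k \<in> carrier G" using g word_ball_in by blast
    \<comment> \<open>A termwise lower bound with an explicit sum: the hump at \<open>k\<close>, the worst case for the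
      earlier terms, and a geometric allowance for the later ones.\<close>
    define lower :: "nat \<Rightarrow> real" where
      "lower j = (if j = k then 4 ^ k else 0) - (if j \<in> {..<k} then 4 ^ j else 0) - (1/2) ^ j" for j
    have lower_sums: "lower sums (4 ^ k - (\<Sum>j<k. 4 ^ j) - 2)"
      unfolding lower_def using geometric_sums[of "1/2::real"]
      by (intro sums_diff sums_single sums_If_finite_set) auto
    have "lower j \<le> a j (g k) (z k)" for j
    proof (cases j k rule: linorder_cases)
      case less
      have "- 1 \<le> u j (\<alpha> (g k) (z k)) - u j (z k)"
        using u_bounds[OF z, of j k] u_bounds[OF act_in[OF gk z], of j k] by linarith
      then have "4 ^ j * - 1 \<le> a j (g k) (z k)"
        unfolding a_def by (rule mult_left_mono) simp
      moreover have "lower j \<le> - (4 ^ j)" using less by (simp add: lower_def)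
      ultimately show ?thesis by simp
    next
      case equal
      then show ?thesis using u_jump[of k] by (simp add: lower_def a_def)
    next
      case greater
      have "\<bar>a j (g k) (z k)\<bar> \<le> real (Suc (slowness k)) * (4 ^ j / real (slowness j))"
        by (rule a_slow[OF g z])
      also have "\<dots> \<le> (1/2) ^ j" by (rule slowness_gap[OF greater])
      finally show ?thesis using greater by (simp add: lower_def)
    qed
    then have "4 ^ k - (\<Sum>j<k. 4 ^ j) - 2 \<le> (\<Sum>j. a j (g k) (z k))"
      using suminf_le[OF _ sums_summable[OF lower_sums] sum_a[OF gk z]] sums_unique[OF lower_sums]
      by simp
    also have "\<dots> = v (\<alpha> (g k) (z k)) - v (z k)"
      using fun_cong[OF fun_cong[OF v(2), of "g k"], of "z k"] gk z
      by (simp add: c_def coboundary_def)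
    also have "\<dots> \<le> 2 * B" using B[OF z, of k] B[OF act_in[OF gk z], of k] by linarith
    finally have "4 ^ k - (\<Sum>j<k. 4 ^ j) \<le> 2 * B + 2" by simp
    moreover have "(\<Sum>j<k. 4 ^ j) = ((4 ^ k :: real) - 1) / 3"
      by (induction k) (simp_all add: field_simps)
    moreover have "0 < (2 ^ k :: real)" "2 ^ k \<le> (4 ^ k :: real)" by (simp, rule power_mono) auto
    ultimately show ?thesis by argo
  qed
  moreover obtain k where "2 * (2 * B + 2) < 2 ^ k" using real_arch_pow[of 2] by auto
  ultimately show False using not_le by blast
qed

end

theorem theoremA:
  fixes G :: "('g, 'b) monoid_scheme"
    and S :: "'g set"
    and M :: "'a::metric_space set"
    and \<alpha> :: "'g \<Rightarrow> 'a \<Rightarrow> 'a"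
  assumes "group G"
    and "finite S" and "S \<subseteq> carrier G" and "generate G S = carrier G"
    and "m_inv G ` S = S" and "\<one>\<^bsub>G\<^esub> \<notin> S"
    and "compact M"
    and "\<alpha> \<in> hom G (Homeo M)"
  shows "cohomologically_C0_stable G S M \<alpha> \<longleftrightarrow> periodic_action G \<alpha>"
proof -
  interpret finitely_generated_action G S M \<alpha>
    using assms by (simp add: finitely_generated_action_def finitely_generated_action_axioms_def)
  show ?thesis
    using stable_if_periodic not_stable_if_not_periodic by blast
qed

end
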